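(* Let $n\ge 1$, let $t\in\mathbb{R}$ with $1\le t\le\sqrt n$, let $\mathbf v\in\mathbb{R}^n$, and let $k,\lambda_j,I_j,s_j,w_j,\varphi_j,j_t$ be as defined in the context. Then: (i) For $j<j_t$, $\varphi_j$ is concave on $\mathbb{R}$ and strictly increasing on $(-\infty,\lambda_j]$. (ii) If $j\ge j_t$ and $I_{j_t}>t^2$, then $\varphi_j$ is convex and strictly decreasing on $(-\infty,\lambda_j]$. If $j>j_t$ and $I_{j_t}=t^2$, then $\varphi_j$ is convex on $\mathbb{R}$ and strictly decreasing on $(-\infty,\lambda_j]$, and $$\varphi_{j_t}(\lambda)\equiv s_{j_t}^2-t^2w_{j_t}\le 0\quad\text{for all }\lambda\in\mathbb{R},$$ where the equality (to $0$) holds only if $I_1=t^2$. (iii) For $j>j_t$, $\varphi_j(\lambda_j)=\varphi_{j-1}(\lambda_j)$ and $\varphi_j(\lambda)>\varphi_{j-1}(\lambda)$ for any $\lambda<\lambda_j$. (iv) For $j\ge j_t$, the smaller root of $\varphi_j(\lambda)=0$ is $$\lambda_j^\varphi=\frac1{I_j}\left(s_j-t\sqrt{\frac{I_jw_j-s_j^2}{I_j-t^2}}\right).$$ There is no root of $\varphi_j(\lambda)=0$ if $2\le j<j_t$.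
   Context: Let $\lambda_1>\lambda_2>\dots>\lambda_k$ be the distinct values among the components of $\mathbf v$. For $j=1,\dots,k$ let $\mathcal I_j=\{i: v_i\ge\lambda_j\}$, $I_j=|\mathcal I_j|$, $s_j=\sum_{i\in\mathcal I_j}v_i$, $w_j=\sum_{i\in\mathcal I_j}v_i^2$, and define the function $\varphi_j:\mathbb{R}\to\mathbb{R}$ by $$\varphi_j(\lambda)=(I_j-t^2)(I_j\lambda-2s_j)\lambda+s_j^2-t^2w_j .$$ Let $j_t=\min\{j\in\{1,\dots,k\}: I_j\ge t^2\}$ (which exists since $I_k=n\ge t^2$). All indices $j$ range over $\{1,\dots,k\}$, and roots are real roots.
   Formalization: In (iv) the formula for the smaller root is stated only for those j ≥ j_t with I_j ≠ t²; if I_j = t² (possible only for j = j_t) the formula divides by zero and φ_j is constant, so it has no smaller root. *)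

theory Defs
  imports "HOL-Analysis.Analysis"
begin

definition num_levels :: "real ^ 'n \<Rightarrow> nat" where
  "num_levels v = card (range (\<lambda>i. v $ i))"

(* The distinct components in decreasing order.  Indices are 1-based: only
   level v j with 1 \<le> j \<le> num_levels v is meaningful. *)
definition level :: "real ^ 'n \<Rightarrow> nat \<Rightarrow> real" where
  "level v j = rev (sorted_list_of_set (range (\<lambda>i. v $ i))) ! (j - 1)"

definition upper_set :: "real ^ 'n \<Rightarrow> nat \<Rightarrow> 'n set" where
  "upper_set v j = {i. level v j \<le> v $ i}"

definition upper_card :: "real ^ 'n \<Rightarrow> nat \<Rightarrow> nat" where
  "upper_card v j = card (upper_set v j)"

definition upper_sum :: "real ^ 'n \<Rightarrow> nat \<Rightarrow> real" where
  "upper_sum v j = (\<Sum>i\<in>upper_set v j. v $ i)"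

definition upper_sumsq :: "real ^ 'n \<Rightarrow> nat \<Rightarrow> real" where
  "upper_sumsq v j = (\<Sum>i\<in>upper_set v j. (v $ i)\<^sup>2)"

definition phi :: "real \<Rightarrow> real ^ 'n \<Rightarrow> nat \<Rightarrow> real \<Rightarrow> real" where
  "phi t v j x =
     (real (upper_card v j) - t\<^sup>2) * (real (upper_card v j) * x - 2 * upper_sum v j) * x
     + (upper_sum v j)\<^sup>2 - t\<^sup>2 * upper_sumsq v j"

(* Min ranges over a nonempty set as soon as t\<^sup>2 \<le> CARD('n). *)
definition crit_index :: "real \<Rightarrow> real ^ 'n \<Rightarrow> nat" where
  "crit_index t v = Min {j \<in> {1..num_levels v}. t\<^sup>2 \<le> real (upper_card v j)}"

(* The closed form for the smaller root of phi t v j; its value carries no meaning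
   when upper_card v j = t\<^sup>2, since the quotient under the root is then x / 0. *)
definition phi_root :: "real \<Rightarrow> real ^ 'n \<Rightarrow> nat \<Rightarrow> real" where
  "phi_root t v j =
     1 / real (upper_card v j) *
     (upper_sum v j
      - t * sqrt ((real (upper_card v j) * upper_sumsq v j - (upper_sum v j)\<^sup>2)
                  / (real (upper_card v j) - t\<^sup>2)))"

definition smaller_root :: "(real \<Rightarrow> real) \<Rightarrow> real \<Rightarrow> bool" where
  "smaller_root f r \<longleftrightarrow> f r = 0 \<and> (\<forall>x. f x = 0 \<longrightarrow> r \<le> x)"

lemma level_image: "level v ` {1..num_levels v} = range (\<lambda>i. v $ i)"
proof -
  let ?xs = "rev (sorted_list_of_set (range (\<lambda>i. v $ i)))"
  have len: "length ?xs = num_levels v"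
    by (simp add: num_levels_def)
  have "level v ` {1..num_levels v} = (\<lambda>j. ?xs ! j) ` {0..<num_levels v}"
  proof -
    have "(\<lambda>j. j - 1) ` {1..num_levels v} = {0..<num_levels v}"
      by (force simp: image_iff intro: bexI[where x = "Suc _"])
    then show ?thesis
      by (simp add: level_def image_image flip: \<open>(\<lambda>j. j - 1) ` {1..num_levels v} = {0..<num_levels v}\<close>)
  qed
  also have "\<dots> = set ?xs"
    using len by (metis list.set_map map_nth set_upt)
  finally show ?thesis by simp
qed

lemma level_strict_antimono: "strict_antimono_on {1..num_levels v} (level v)"
proof (rule monotone_onI)
  fix i j :: nat
  assume ij: "i \<in> {1..num_levels v}" "j \<in> {1..num_levels v}" "i < j"
  let ?xs = "sorted_list_of_set (range (\<lambda>i. v $ i))"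
  have len: "length ?xs = num_levels v"
    by (simp add: num_levels_def)
  have "?xs ! (num_levels v - j) < ?xs ! (num_levels v - i)"
    using ij len by (intro sorted_wrt_nth_less[OF strict_sorted_list_of_set]) auto
  then show "level v j < level v i"
    using ij len by (simp add: level_def rev_nth)
qed

end

theory Submission
  imports Defs
begin

text \<open>
  The statement rests on one identity, seen by expanding both sums,
  \[ \varphi_j(x) = \Bigl(\sum_{i\in\mathcal I_j}(v_i-x)\Bigr)^2
       - t^2 \sum_{i\in\mathcal I_j}(v_i-x)^2 \]
  (lemma \<open>phi_centred\<close>), together with the ordinary view of \<open>phi t v j\<close> as a quadratic in \<open>x\<close>
  with leading coefficient $I_j(I_j-t^2)$, vertex at the mean $s_j/I_j$ and reduced discriminant
  $(I_j-t^2)\,t^2\,(I_jw_j-s_j^2)$.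

  Parts (i) and (ii): the sign of $I_j-t^2$ decides between concave and convex, and it is negative
  exactly for $j<j_t$ because $I_j$ strictly increases with $j$.  All entries indexed by
  $\mathcal I_j$ are at least $\lambda_j$, so the vertex is at least $\lambda_j$ and
  the function is strictly monotone up to $\lambda_j$.  When $I_j=t^2$ only the
  constant $s_j^2-I_jw_j$ remains, and this is $-I_j^2$ times the variance of the entries
  indexed by $\mathcal I_j$; it vanishes only if these entries are all equal, that is, if $j=1$.

  Part (iii): passing from $j-1$ to $j$ adds $m$ entries, all equal to $\lambda_j$.  With
  $d=\lambda_j-x$ and $S=\sum_{i\in\mathcal I_{j-1}}(v_i-x)$ the centred form gives
  $\varphi_j(x)-\varphi_{j-1}(x)=m\,d\,(2S+md-t^2d)$.  This is zero for $d=0$, and it is positive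
  for $d>0$ because $S\ge I_{j-1}d\ge t^2d$.

  Part (iv): the discriminant is nonnegative for $I_j>t^2$, which yields the displayed root.  It is
  negative if $I_j<t^2$ and $j\ge 2$, since the variance of at least two distinct values is
  positive.
\<close>

section \<open>Variance and quadratics\<close>

text \<open>Both sides are \<open>(card A)\<^sup>2\<close> times the variance of \<open>f\<close> on \<open>A\<close>.  The right-hand side shows
  at once when the Cauchy-Schwarz inequality against the constant one is strict.\<close>
lemma card_sumsq_minus_sum_sq:
  fixes f :: "'a \<Rightarrow> real"
  assumes "finite A" "A \<noteq> {}"
  defines "m \<equiv> sum f A / card A"
  shows "card A * (\<Sum>i\<in>A. (f i)\<^sup>2) - (sum f A)\<^sup>2 = card A * (\<Sum>i\<in>A. (f i - m)\<^sup>2)"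
proof -
  have N: "real (card A) > 0" using assms by (simp add: card_gt_0_iff)
  have s: "sum f A = card A * m" using N by (simp add: m_def)
  have "(\<Sum>i\<in>A. (f i - m)\<^sup>2) = (\<Sum>i\<in>A. (f i)\<^sup>2 - 2 * m * f i + m\<^sup>2)"
    by (simp add: power2_diff algebra_simps)
  also have "\<dots> = (\<Sum>i\<in>A. (f i)\<^sup>2) - 2 * m * sum f A + card A * m\<^sup>2"
    by (simp add: sum.distrib sum_subtractf sum_distrib_left)
  finally show ?thesis unfolding s by (simp only:) (simp add: algebra_simps power2_eq_square)
qed

lemma sum_sq_le_card_sumsq:
  fixes f :: "'a \<Rightarrow> real"
  assumes "finite A"
  shows "(sum f A)\<^sup>2 \<le> card A * (\<Sum>i\<in>A. (f i)\<^sup>2)"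
proof (cases "A = {}")
  case False
  have "0 \<le> card A * (\<Sum>i\<in>A. (f i - sum f A / card A)\<^sup>2)"
    by (intro mult_nonneg_nonneg sum_nonneg) auto
  then show ?thesis using card_sumsq_minus_sum_sq[OF assms False, of f] by linarith
qed auto

text \<open>Two distinct values cannot both equal the mean, so some squared deviation is positive.\<close>
lemma sum_sq_less_card_sumsq:
  fixes f :: "'a \<Rightarrow> real"
  assumes "finite A" "a \<in> A" "b \<in> A" "f a \<noteq> f b"
  shows "(sum f A)\<^sup>2 < card A * (\<Sum>i\<in>A. (f i)\<^sup>2)"
proof -
  let ?m = "sum f A / card A"
  have ne: "A \<noteq> {}" using assms by auto
  have "f a \<noteq> ?m \<or> f b \<noteq> ?m" using assms(4) by auto
  then obtain i where "i \<in> A" "f i \<noteq> ?m" using assms(2,3) by blast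
  then have "0 < (\<Sum>i\<in>A. (f i - ?m)\<^sup>2)"
    using assms(1) by (intro sum_pos2[of A i]) auto
  then have "0 < card A * (\<Sum>i\<in>A. (f i - ?m)\<^sup>2)"
    using assms(1) ne by (simp add: card_gt_0_iff)
  then show ?thesis using card_sumsq_minus_sum_sq[OF assms(1) ne, of f] by linarith
qed

lemma convex_on_quadratic:
  fixes a b c :: real
  assumes "0 \<le> a"
  shows "convex_on UNIV (\<lambda>x. a * x\<^sup>2 + b * x + c)"
proof (rule convex_onI)
  fix u x y :: real
  assume u: "0 < u" "u < 1"
  have "(1 - u) * (a * x\<^sup>2 + b * x + c) + u * (a * y\<^sup>2 + b * y + c)
      - (a * ((1 - u) * x + u * y)\<^sup>2 + b * ((1 - u) * x + u * y) + c)
      = a * (u * (1 - u)) * (x - y)\<^sup>2"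
    by (simp add: power2_eq_square algebra_simps)
  moreover have "0 \<le> a * (u * (1 - u)) * (x - y)\<^sup>2" using assms u by simp
  ultimately show "a * ((1 - u) *\<^sub>R x + u *\<^sub>R y)\<^sup>2 + b * ((1 - u) *\<^sub>R x + u *\<^sub>R y) + c
      \<le> (1 - u) * (a * x\<^sup>2 + b * x + c) + u * (a * y\<^sup>2 + b * y + c)"
    by simp
qed auto

section \<open>Levels and upper sets\<close>

lemma num_levels_pos: "1 \<le> num_levels v"
  by (simp add: num_levels_def card_gt_0_iff Suc_le_eq)

lemma component_eq_level:
  obtains j where "j \<in> {1..num_levels v}" "v $ i = level v j"
proof -
  have "v $ i \<in> level v ` {1..num_levels v}" by (simp only: level_image) simp
  then show thesis using that by auto
qed

lemma level_eq_component:
  assumes "j \<in> {1..num_levels v}"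
  obtains i where "v $ i = level v j"
proof -
  have "level v j \<in> range (\<lambda>i. v $ i)" using assms level_image[of v] by blast
  then show thesis using that by auto
qed

lemma level_less:
  "\<lbrakk>i \<in> {1..num_levels v}; j \<in> {1..num_levels v}; i < j\<rbrakk> \<Longrightarrow> level v j < level v i"
  using level_strict_antimono[of v] by (auto simp: monotone_on_def)

lemma level_le_iff:
  "\<lbrakk>i \<in> {1..num_levels v}; j \<in> {1..num_levels v}\<rbrakk> \<Longrightarrow> level v j \<le> level v i \<longleftrightarrow> i \<le> j"
  using level_less[of i v j] level_less[of j v i] by (cases i j rule: linorder_cases) auto

lemma upper_set_nonempty: "j \<in> {1..num_levels v} \<Longrightarrow> upper_set v j \<noteq> {}"
  by (metis (mono_tags, lifting) level_eq_component empty_iff mem_Collect_eq order_refl upper_set_def)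

lemma upper_card_pos: "j \<in> {1..num_levels v} \<Longrightarrow> 0 < upper_card v j"
  using upper_set_nonempty by (simp add: upper_card_def card_gt_0_iff)

lemma upper_card_strict_mono:
  assumes "i \<in> {1..num_levels v}" "j \<in> {1..num_levels v}" "i < j"
  shows "upper_card v i < upper_card v j"
proof -
  obtain c where c: "v $ c = level v j" using level_eq_component[OF assms(2)] .
  have less: "level v j < level v i" using level_less assms by blast
  have "upper_set v i \<subset> upper_set v j"
  proof
    show "upper_set v i \<subseteq> upper_set v j" using less by (auto simp: upper_set_def)
    have "c \<in> upper_set v j" "c \<notin> upper_set v i" using c less by (auto simp: upper_set_def)
    then show "upper_set v i \<noteq> upper_set v j" by blast
  qed
  then show ?thesis unfolding upper_card_def by (intro psubset_card_mono) auto
qed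

lemma upper_set_last: "upper_set v (num_levels v) = UNIV"
proof -
  have "level v (num_levels v) \<le> v $ i" for i
  proof -
    obtain j where "j \<in> {1..num_levels v}" "v $ i = level v j" by (rule component_eq_level)
    then show ?thesis using level_le_iff[of j v "num_levels v"] by simp
  qed
  then show ?thesis by (auto simp: upper_set_def)
qed

text \<open>No component lies strictly between consecutive levels.\<close>
lemma upper_set_step:
  assumes "j \<in> {1..num_levels v}" "1 < j"
  shows "upper_set v j = upper_set v (j - 1) \<union> {i. v $ i = level v j}"
    and "upper_set v (j - 1) \<inter> {i. v $ i = level v j} = {}"
proof -
  have j': "j - 1 \<in> {1..num_levels v}" using assms by auto
  have less: "level v j < level v (j - 1)" using level_less[OF j' assms(1)] assms(2) by simp
  show "upper_set v (j - 1) \<inter> {i. v $ i = level v j} = {}"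
    using less by (auto simp: upper_set_def)
  have "level v (j - 1) \<le> v $ i \<or> v $ i = level v j" if "level v j \<le> v $ i" for i
  proof -
    obtain l where l: "l \<in> {1..num_levels v}" "v $ i = level v l" by (rule component_eq_level)
    then have "l \<le> j" using that level_le_iff[OF l(1) assms(1)] by simp
    then have "l \<le> j - 1 \<or> l = j" by auto
    then show ?thesis using l level_le_iff[OF l(1) j'] by auto
  qed
  then show "upper_set v j = upper_set v (j - 1) \<union> {i. v $ i = level v j}"
    using less by (auto simp: upper_set_def)
qed

text \<open>The mean of the entries that are at least the level is itself at least the level, so the
  vertex of the quadratic is not to the left of the level.\<close>
lemma upper_card_level_le_upper_sum: "real (upper_card v j) * level v j \<le> upper_sum v j"
  unfolding upper_card_def upper_sum_def
  by (rule sum_bounded_below) (simp add: upper_set_def)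

lemma upper_sum_sq_le: "(upper_sum v j)\<^sup>2 \<le> real (upper_card v j) * upper_sumsq v j"
  unfolding upper_card_def upper_sum_def upper_sumsq_def by (rule sum_sq_le_card_sumsq) simp

lemma upper_sum_sq_less:
  assumes "j \<in> {1..num_levels v}" "1 < j"
  shows "(upper_sum v j)\<^sup>2 < real (upper_card v j) * upper_sumsq v j"
proof -
  have one: "1 \<in> {1..num_levels v}" using assms by auto
  obtain a where a: "v $ a = level v 1" using level_eq_component[OF one] .
  obtain b where b: "v $ b = level v j" using level_eq_component[OF assms(1)] .
  have "level v j < level v 1" using level_less[OF one assms(1,2)] .
  then show ?thesis
    unfolding upper_card_def upper_sum_def upper_sumsq_def
    using a b by (intro sum_sq_less_card_sumsq[where a = a and b = b]) (auto simp: upper_set_def)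
qed

section \<open>The critical index\<close>

lemma crit_index_props:
  fixes v :: "real ^ 'n" and t :: real
  assumes "t\<^sup>2 \<le> CARD('n)"
  shows crit_index_mem: "crit_index t v \<in> {1..num_levels v}"
    and le_upper_card_crit: "t\<^sup>2 \<le> real (upper_card v (crit_index t v))"
    and upper_card_less_below_crit:
      "\<lbrakk>j \<in> {1..num_levels v}; j < crit_index t v\<rbrakk> \<Longrightarrow> real (upper_card v j) < t\<^sup>2"
proof -
  let ?J = "{j \<in> {1..num_levels v}. t\<^sup>2 \<le> real (upper_card v j)}"
  have "num_levels v \<in> ?J"
    using assms num_levels_pos[of v] by (simp add: upper_card_def upper_set_last)
  then have "crit_index t v \<in> ?J"
    unfolding crit_index_def by (intro Min_in) auto
  then show "crit_index t v \<in> {1..num_levels v}" "t\<^sup>2 \<le> real (upper_card v (crit_index t v))" by auto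
  show "real (upper_card v j) < t\<^sup>2" if "j \<in> {1..num_levels v}" "j < crit_index t v"
  proof (rule ccontr)
    assume "\<not> real (upper_card v j) < t\<^sup>2"
    then have "crit_index t v \<le> j"
      unfolding crit_index_def using that by (intro Min_le) auto
    then show False using that by simp
  qed
qed

section \<open>Shape, comparison and roots of the quadratics\<close>

lemma phi_quadratic:
  "phi t v j x = (real (upper_card v j) - t\<^sup>2) * real (upper_card v j) * x\<^sup>2
    + (- 2 * (real (upper_card v j) - t\<^sup>2) * upper_sum v j) * x
    + ((upper_sum v j)\<^sup>2 - t\<^sup>2 * upper_sumsq v j)"
  by (simp add: phi_def power2_eq_square algebra_simps)

text \<open>In this form each component enters only through its distance from \<open>x\<close>, which makes visible
  what adding the components at one more level does.\<close>
lemma phi_centred: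
  "phi t v j x = (\<Sum>i\<in>upper_set v j. v $ i - x)\<^sup>2 - t\<^sup>2 * (\<Sum>i\<in>upper_set v j. (v $ i - x)\<^sup>2)"
proof -
  have "(\<Sum>i\<in>upper_set v j. v $ i - x) = upper_sum v j - real (upper_card v j) * x"
    by (simp add: sum_subtractf upper_sum_def upper_card_def)
  moreover have "(\<Sum>i\<in>upper_set v j. (v $ i - x)\<^sup>2)
      = (\<Sum>i\<in>upper_set v j. (v $ i)\<^sup>2 - 2 * x * v $ i + x\<^sup>2)"
    by (simp add: power2_diff algebra_simps)
  then have "(\<Sum>i\<in>upper_set v j. (v $ i - x)\<^sup>2)
      = upper_sumsq v j - 2 * x * upper_sum v j + real (upper_card v j) * x\<^sup>2"
    by (simp add: sum.distrib sum_subtractf sum_distrib_left upper_sum_def upper_sumsq_def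
        upper_card_def)
  ultimately show ?thesis
    by (simp only: phi_def) (simp add: power2_eq_square algebra_simps)
qed

text \<open>The factor that depends on the points is kept apart from \<open>I\<^sub>j - t\<^sup>2\<close>: it has the same sign
  for all \<open>x < y\<close> below the level, so the direction of monotonicity is decided by the first
  factor alone.\<close>
lemma phi_diff:
  "phi t v j y - phi t v j x =
    (real (upper_card v j) - t\<^sup>2) * ((y - x) * (real (upper_card v j) * (x + y) - 2 * upper_sum v j))"
  by (simp add: phi_def power2_eq_square algebra_simps)

lemma phi_diff_factor_neg:
  assumes "j \<in> {1..num_levels v}" "x < y" "y \<le> level v j"
  shows "(y - x) * (real (upper_card v j) * (x + y) - 2 * upper_sum v j) < 0"
proof -
  have "real (upper_card v j) * (x + y) < real (upper_card v j) * (2 * level v j)"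
    using assms upper_card_pos[OF assms(1)] by (intro mult_strict_left_mono) auto
  also have "\<dots> \<le> 2 * upper_sum v j" using upper_card_level_le_upper_sum[of v j] by simp
  finally show ?thesis using assms(2) by (intro mult_pos_neg) auto
qed

lemma phi_concave_mono:
  assumes "j \<in> {1..num_levels v}" "real (upper_card v j) < t\<^sup>2"
  shows "concave_on UNIV (phi t v j)" "strict_mono_on {..level v j} (phi t v j)"
proof -
  let ?a = "(t\<^sup>2 - real (upper_card v j)) * real (upper_card v j)"
  let ?b = "2 * (real (upper_card v j) - t\<^sup>2) * upper_sum v j"
  let ?c = "t\<^sup>2 * upper_sumsq v j - (upper_sum v j)\<^sup>2"
  have "convex_on UNIV (\<lambda>x. ?a * x\<^sup>2 + ?b * x + ?c)"
    using assms(2) by (intro convex_on_quadratic) auto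
  moreover have "(\<lambda>x. ?a * x\<^sup>2 + ?b * x + ?c) = (\<lambda>x. - phi t v j x)"
    by (simp add: phi_quadratic fun_eq_iff algebra_simps)
  ultimately show "concave_on UNIV (phi t v j)" by (simp add: concave_on_def)
  show "strict_mono_on {..level v j} (phi t v j)"
  proof (rule strict_mono_onI)
    fix x y assume "x \<in> {..level v j}" "y \<in> {..level v j}" "x < y"
    then have "0 < phi t v j y - phi t v j x"
      unfolding phi_diff using assms(2)
      by (intro mult_neg_neg phi_diff_factor_neg[OF assms(1)]) simp_all
    then show "phi t v j x < phi t v j y" by simp
  qed
qed

lemma phi_convex_antimono:
  assumes "j \<in> {1..num_levels v}" "t\<^sup>2 < real (upper_card v j)"
  shows "convex_on UNIV (phi t v j)" "strict_antimono_on {..level v j} (phi t v j)"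
proof -
  show "convex_on UNIV (phi t v j)"
    unfolding phi_quadratic[abs_def] using assms(2) by (intro convex_on_quadratic) auto
  show "strict_antimono_on {..level v j} (phi t v j)"
  proof (rule monotone_onI)
    fix x y assume "x \<in> {..level v j}" "y \<in> {..level v j}" "x < y"
    then have "phi t v j y - phi t v j x < 0"
      unfolding phi_diff using assms(2)
      by (intro mult_pos_neg phi_diff_factor_neg[OF assms(1)]) simp_all
    then show "phi t v j y < phi t v j x" by simp
  qed
qed

text \<open>The components added between \<open>j - 1\<close> and \<open>j\<close> all have the same deviation
  \<open>level v j - x\<close>, so the increment has this deviation as a factor and vanishes at the level.\<close>
lemma phi_step:
  fixes v :: "real ^ 'n"
  assumes "j \<in> {1..num_levels v}" "1 < j"
  defines "m \<equiv> real (card {i. v $ i = level v j})"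
  shows "phi t v j x - phi t v (j - 1) x =
    m * (level v j - x) *
      (2 * (\<Sum>i\<in>upper_set v (j - 1). v $ i - x) + m * (level v j - x) - t\<^sup>2 * (level v j - x))"
proof -
  let ?E = "{i. v $ i = level v j}"
  note split = sum.union_disjoint[OF _ _ upper_set_step(2)[OF assms(1,2)],
      folded upper_set_step(1)[OF assms(1,2)]]
  have "(\<Sum>i\<in>?E. v $ i - x) = m * (level v j - x)"
    "(\<Sum>i\<in>?E. (v $ i - x)\<^sup>2) = m * (level v j - x)\<^sup>2"
    by (simp_all add: m_def)
  then have
    "(\<Sum>i\<in>upper_set v j. v $ i - x) = (\<Sum>i\<in>upper_set v (j-1). v $ i - x) + m * (level v j - x)"
    "(\<Sum>i\<in>upper_set v j. (v $ i - x)\<^sup>2)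
      = (\<Sum>i\<in>upper_set v (j-1). (v $ i - x)\<^sup>2) + m * (level v j - x)\<^sup>2"
    by (simp_all add: split)
  then show ?thesis
    by (simp only: phi_centred) (simp add: power2_eq_square algebra_simps)
qed

text \<open>Each component counted at \<open>j - 1\<close> exceeds \<open>x\<close> by at least \<open>d = level v j - x\<close>, so their total
  deviation \<open>S\<close> is at least \<open>t\<^sup>2 * d\<close>; this outweighs the only negative term of the increment.\<close>
lemma phi_less_step:
  assumes "j \<in> {1..num_levels v}" "1 < j" "t\<^sup>2 \<le> real (upper_card v (j - 1))" "x < level v j"
  shows "phi t v (j - 1) x < phi t v j x"
proof -
  define d where "d = level v j - x"
  define m where "m = real (card {i. v $ i = level v j})"
  define S where "S = (\<Sum>i\<in>upper_set v (j - 1). v $ i - x)"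
  have d: "0 < d" using assms by (simp add: d_def)
  obtain c where "v $ c = level v j" using level_eq_component[OF assms(1)] .
  then have m: "0 < m" by (auto simp: m_def card_gt_0_iff)
  have "level v j < level v (j - 1)" using assms(1,2) by (intro level_less) auto
  then have "real (upper_card v (j - 1)) * d \<le> S"
    unfolding S_def d_def upper_card_def by (intro sum_bounded_below) (auto simp: upper_set_def)
  moreover have "t\<^sup>2 * d \<le> real (upper_card v (j - 1)) * d"
    using assms(3) d by (intro mult_right_mono) auto
  moreover have "0 \<le> t\<^sup>2 * d" "0 < m * d" using d m by auto
  ultimately have "0 < 2 * S + m * d - t\<^sup>2 * d" by linarith
  then have "0 < m * d * (2 * S + m * d - t\<^sup>2 * d)" using d m by simp
  also have "\<dots> = phi t v j x - phi t v (j - 1) x"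
    using phi_step[OF assms(1,2)] by (simp add: d_def m_def S_def)
  finally show ?thesis by simp
qed

text \<open>Completing the square in \<open>x\<close>.  The second term is a multiple of a variance, so for a cardinality above
  \<open>t\<^sup>2\<close> the roots are symmetric about the mean, and below \<open>t\<^sup>2\<close> no term is positive.\<close>
lemma upper_card_mult_phi:
  "real (upper_card v j) * phi t v j x =
    (real (upper_card v j) - t\<^sup>2) * (real (upper_card v j) * x - upper_sum v j)\<^sup>2
    - t\<^sup>2 * (real (upper_card v j) * upper_sumsq v j - (upper_sum v j)\<^sup>2)"
  by (simp add: phi_def power2_eq_square algebra_simps)

lemma smaller_root_phi:
  assumes j: "j \<in> {1..num_levels v}" and t: "0 \<le> t" and big: "t\<^sup>2 < real (upper_card v j)"
  shows "smaller_root (phi t v j) (phi_root t v j)"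
proof -
  define N where "N = real (upper_card v j)"
  define s where "s = upper_sum v j"
  define D where "D = N * upper_sumsq v j - s\<^sup>2"
  define r where "r = t * sqrt (D / (N - t\<^sup>2))"
  have N: "0 < N" using upper_card_pos[OF j] by (simp add: N_def)
  have A: "0 < N - t\<^sup>2" using big by (simp add: N_def)
  have "0 \<le> D" using upper_sum_sq_le[of v j] by (simp add: D_def N_def s_def)
  then have r: "0 \<le> r" "(N - t\<^sup>2) * r\<^sup>2 = t\<^sup>2 * D"
    using t A by (simp_all add: r_def power_mult_distrib)
  have root: "phi_root t v j = (s - r) / N"
    by (simp add: phi_root_def N_def s_def D_def r_def)
  have "N * phi t v j x = (N - t\<^sup>2) * ((N * x - s)\<^sup>2 - r\<^sup>2)" for x
    using upper_card_mult_phi[of v j t x] r(2) by (simp add: N_def s_def D_def right_diff_distrib)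
  then have zero_iff: "phi t v j x = 0 \<longleftrightarrow> (N * x - s)\<^sup>2 = r\<^sup>2" for x
    using N A by (metis diff_gt_0_iff_gt eq_iff_diff_eq_0 less_irrefl mult_eq_0_iff)
  show ?thesis
    unfolding smaller_root_def
  proof (intro conjI allI impI)
    show "phi t v j (phi_root t v j) = 0" using N by (simp add: zero_iff root)
    fix x assume "phi t v j x = 0"
    then have "\<bar>N * x - s\<bar> = r" using r(1) by (auto simp: zero_iff power2_eq_iff)
    then have "s - r \<le> x * N" by (simp add: mult.commute)
    then show "phi_root t v j \<le> x" using N by (simp add: root pos_divide_le_eq)
  qed
qed

lemma phi_neg:
  assumes "j \<in> {1..num_levels v}" "1 < j" "0 < t" "real (upper_card v j) < t\<^sup>2"
  shows "phi t v j x < 0"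
proof -
  have "(real (upper_card v j) - t\<^sup>2) * (real (upper_card v j) * x - upper_sum v j)\<^sup>2 \<le> 0"
    using assms(4) by (intro mult_nonpos_nonneg) auto
  moreover have "0 < t\<^sup>2 * (real (upper_card v j) * upper_sumsq v j - (upper_sum v j)\<^sup>2)"
    using upper_sum_sq_less[OF assms(1,2)] assms(3) by simp
  ultimately have "real (upper_card v j) * phi t v j x < 0"
    unfolding upper_card_mult_phi by linarith
  then show ?thesis by (simp add: mult_less_0_iff)
qed

section \<open>The four properties\<close>

theorem lemma3p2:
  fixes v :: "real ^ 'n" and t :: real
  assumes "1 \<le> t" and "t \<le> sqrt (real CARD('n))"
  shows
    "(\<forall>j\<in>{1..num_levels v}. j < crit_index t v \<longrightarrow>
        concave_on UNIV (phi t v j) \<and> strict_mono_on {..level v j} (phi t v j))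
     \<and>
     ((\<forall>j\<in>{1..num_levels v}. crit_index t v \<le> j \<and> t\<^sup>2 < real (upper_card v (crit_index t v)) \<longrightarrow>
        convex_on UNIV (phi t v j) \<and> strict_antimono_on {..level v j} (phi t v j))
      \<and> (\<forall>j\<in>{1..num_levels v}. crit_index t v < j \<and> real (upper_card v (crit_index t v)) = t\<^sup>2 \<longrightarrow>
        convex_on UNIV (phi t v j) \<and> strict_antimono_on {..level v j} (phi t v j))
      \<and> (real (upper_card v (crit_index t v)) = t\<^sup>2 \<longrightarrow>
          (\<forall>x. phi t v (crit_index t v) x
                 = (upper_sum v (crit_index t v))\<^sup>2 - t\<^sup>2 * upper_sumsq v (crit_index t v))
          \<and> (upper_sum v (crit_index t v))\<^sup>2 - t\<^sup>2 * upper_sumsq v (crit_index t v) \<le> 0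
          \<and> ((upper_sum v (crit_index t v))\<^sup>2 - t\<^sup>2 * upper_sumsq v (crit_index t v) = 0
               \<longrightarrow> real (upper_card v 1) = t\<^sup>2)))
     \<and>
     (\<forall>j\<in>{1..num_levels v}. crit_index t v < j \<longrightarrow>
        phi t v j (level v j) = phi t v (j - 1) (level v j)
        \<and> (\<forall>x < level v j. phi t v (j - 1) x < phi t v j x))
     \<and>
     ((\<forall>j\<in>{1..num_levels v}. crit_index t v \<le> j \<and> real (upper_card v j) \<noteq> t\<^sup>2 \<longrightarrow>
        smaller_root (phi t v j) (phi_root t v j))
      \<and> (\<forall>j\<in>{1..num_levels v}. 2 \<le> j \<and> j < crit_index t v \<longrightarrow> (\<nexists>x. phi t v j x = 0)))"
proof -
  let ?c = "crit_index t v"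
  have t: "0 < t" using assms(1) by simp
  have "t\<^sup>2 \<le> (sqrt (CARD('n)))\<^sup>2" using assms t by (intro power_mono) auto
  then have "t\<^sup>2 \<le> CARD('n)" by simp
  note c = crit_index_props[OF this, where v = v]
  have above: "t\<^sup>2 < real (upper_card v j)" if "j \<in> {1..num_levels v}" "?c < j" for j
    using upper_card_strict_mono[OF c(1) that] c(2) by linarith
  have weakly_above: "t\<^sup>2 \<le> real (upper_card v j)" if "j \<in> {1..num_levels v}" "?c \<le> j" for j
    using above[OF that(1)] c(2) that(2) by (cases "j = ?c") auto
  have i: "concave_on UNIV (phi t v j) \<and> strict_mono_on {..level v j} (phi t v j)"
    if "j \<in> {1..num_levels v}" "j < ?c" for j
    using phi_concave_mono c(3) that by blast
  have ii_shape: "convex_on UNIV (phi t v j) \<and> strict_antimono_on {..level v j} (phi t v j)"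
    if "j \<in> {1..num_levels v}" "t\<^sup>2 < real (upper_card v j)" for j
    using phi_convex_antimono that by blast
  have ii_gt: "t\<^sup>2 < real (upper_card v j)"
    if "j \<in> {1..num_levels v}" "?c \<le> j" "t\<^sup>2 < real (upper_card v ?c)" for j
    using above[OF that(1)] that(2,3) by (cases "j = ?c") auto
  have ii_const: "phi t v ?c x = (upper_sum v ?c)\<^sup>2 - t\<^sup>2 * upper_sumsq v ?c"
    if "real (upper_card v ?c) = t\<^sup>2" for x
    using that by (simp add: phi_def)
  have ii_le: "(upper_sum v ?c)\<^sup>2 - t\<^sup>2 * upper_sumsq v ?c \<le> 0" if "real (upper_card v ?c) = t\<^sup>2"
    using upper_sum_sq_le[of v ?c] that by simp
  have ii_eq: "real (upper_card v 1) = t\<^sup>2"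
    if "real (upper_card v ?c) = t\<^sup>2" "(upper_sum v ?c)\<^sup>2 - t\<^sup>2 * upper_sumsq v ?c = 0"
  proof (cases "1 < ?c")
    case True
    then show ?thesis using upper_sum_sq_less[OF c(1) True] that by simp
  next
    case False
    then have "?c = 1" using c(1) by auto
    then show ?thesis using that(1) by simp
  qed
  have iii: "phi t v j (level v j) = phi t v (j - 1) (level v j)
      \<and> (\<forall>x < level v j. phi t v (j - 1) x < phi t v j x)"
    if j: "j \<in> {1..num_levels v}" "?c < j" for j
  proof -
    have j1: "1 < j" using c(1) j by auto
    have "t\<^sup>2 \<le> real (upper_card v (j - 1))" using j j1 by (intro weakly_above) auto
    then show ?thesis
      using phi_less_step[OF j(1) j1] phi_step[OF j(1) j1, of t "level v j"] by simp
  qed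
  have iv_root: "smaller_root (phi t v j) (phi_root t v j)"
    if "j \<in> {1..num_levels v}" "?c \<le> j" "real (upper_card v j) \<noteq> t\<^sup>2" for j
    using smaller_root_phi[OF that(1)] weakly_above[OF that(1,2)] that(3) t by simp
  have iv_none: "\<nexists>x. phi t v j x = 0"
    if "j \<in> {1..num_levels v}" "2 \<le> j" "j < ?c" for j
    using phi_neg[OF that(1) _ t c(3)[OF that(1,3)]] that(2)
    by (metis Suc_1 Suc_le_eq less_irrefl)
  show ?thesis
    using i ii_shape ii_gt above ii_const ii_le ii_eq iii iv_root iv_none
    by (intro conjI ballI impI allI) (blast | metis)+
qed

end
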